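(* Let $d\in\mathbb N$, $a\in\mathbb N_0$. For every $n\in\mathbb N_0$, the generalized Bernoulli polynomials $B(d,a;n,x):=\sum_{m=0}^n\binom{n}{m}B(d,a;n-m)\,x^m$ satisfy $$B(d,a;n,x)=\sum_{m=0}^n\binom{n}{m}\,d^m\,B(m)\,(a+x)^{n-m}.$$
   Context: $\mathbb N=\{1,2,\dots\}$, $\mathbb N_0=\{0,1,2,\dots\}$, $0^0:=1$. The ordinary Bernoulli numbers $B(n)$ are defined by $B(0)=1$ and $B(n)=-\frac1{n+1}\sum_{k=0}^{n-1}\binom{n+1}{k}B(k)$ for $n\ge1$ (so $B(1)=-\tfrac12$). The generalized Stirling numbers of the second kind $S2(d,a;n,m)$, $0\le m\le n$, are defined by the operator identity $(a\,\mathbf 1+d\,\mathbf E_x)^n=\sum_{m=0}^n S2(d,a;n,m)\,x^m\,\mathbf d_x^{\,m}$, where $\mathbf d_x$ is differentiation with respect to $x$, $\mathbf E_x:=x\,\mathbf d_x$ and $\mathbf 1$ is the identity operator. The generalized Bernoulli numbers are $B(d,a;n):=\sum_{m=0}^n(-1)^m\frac{1}{m+1}S2(d,a;n,m)\,m!$. *)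

theory Defs
  imports "HOL-Computational_Algebra.Polynomial"
begin

fun bernoulli :: "nat \<Rightarrow> rat" where
  "bernoulli n =
     (if n = 0 then 1
      else - (1 / (of_nat n + 1)) * (\<Sum>k\<in>{0..<n}. of_nat ((n + 1) choose k) * bernoulli k))"

declare bernoulli.simps [simp del]

text \<open>The operator identity defining the generalized Stirling numbers is read on rational
  polynomials in \<open>x\<close>. This already determines the numbers; see
  \<open>gen_stirling2_exists\<close> and \<open>gen_stirling2_unique\<close>.\<close>

definition euler_op :: "rat poly \<Rightarrow> rat poly" where
  "euler_op p = monom 1 1 * pderiv p"

definition gen_euler_op :: "nat \<Rightarrow> nat \<Rightarrow> rat poly \<Rightarrow> rat poly" where
  "gen_euler_op d a p = smult (of_nat a) p + smult (of_nat d) (euler_op p)"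

text \<open>The family \<open>s\<close> is only meant for indices \<open>m \<le> n\<close>; it is set to zero beyond
  so that it is unique as a total function.\<close>

definition is_gen_stirling2 :: "nat \<Rightarrow> nat \<Rightarrow> nat \<Rightarrow> (nat \<Rightarrow> rat) \<Rightarrow> bool" where
  "is_gen_stirling2 d a n s \<longleftrightarrow>
     (\<forall>p. (gen_euler_op d a ^^ n) p = (\<Sum>m=0..n. smult (s m) (monom 1 m * (pderiv ^^ m) p))) \<and>
     (\<forall>m>n. s m = 0)"

definition gen_stirling2 :: "nat \<Rightarrow> nat \<Rightarrow> nat \<Rightarrow> nat \<Rightarrow> rat" where
  "gen_stirling2 d a n = (THE s. is_gen_stirling2 d a n s)"

lemma euler_op_term:
  "euler_op (monom 1 m * (pderiv ^^ m) p) =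
     smult (of_nat m) (monom 1 m * (pderiv ^^ m) p) + monom 1 (Suc m) * (pderiv ^^ Suc m) p"
proof (cases m)
  case 0
  then show ?thesis by (simp add: euler_op_def)
next
  case (Suc k)
  have "monom 1 1 * pderiv (monom 1 m) = (smult (of_nat m) (monom 1 m) :: rat poly)"
    by (simp add: pderiv_monom mult_monom smult_monom Suc)
  moreover have "monom 1 1 * monom 1 m = (monom 1 (Suc m) :: rat poly)"
    by (simp add: mult_monom)
  moreover have "euler_op (monom 1 m * (pderiv ^^ m) p) =
      (monom 1 1 * pderiv (monom 1 m)) * (pderiv ^^ m) p
      + (monom 1 1 * monom 1 m) * pderiv ((pderiv ^^ m) p)"
    unfolding euler_op_def pderiv_mult by (simp only: algebra_simps)
  ultimately show ?thesis by simp
qed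

lemma gen_euler_op_add: "gen_euler_op d a (p + q) = gen_euler_op d a p + gen_euler_op d a q"
  by (simp add: gen_euler_op_def euler_op_def pderiv_add smult_add_right algebra_simps)

lemma gen_euler_op_smult: "gen_euler_op d a (smult c p) = smult c (gen_euler_op d a p)"
  by (simp add: gen_euler_op_def euler_op_def pderiv_smult smult_add_right mult.commute)

lemma gen_euler_op_0: "gen_euler_op d a 0 = 0"
  by (simp add: gen_euler_op_def euler_op_def)

lemma gen_euler_op_sum: "gen_euler_op d a (sum f A) = (\<Sum>i\<in>A. gen_euler_op d a (f i))"
  by (induction A rule: infinite_finite_induct) (simp_all add: gen_euler_op_0 gen_euler_op_add)

lemma gen_stirling2_exists: "\<exists>s. is_gen_stirling2 d a n s"
proof (induction n)
  case 0
  show ?case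
    by (rule exI[of _ "\<lambda>m. if m = 0 then 1 else 0"]) (simp add: is_gen_stirling2_def)
next
  case (Suc n)
  then obtain s where
    s: "\<And>p. (gen_euler_op d a ^^ n) p = (\<Sum>m=0..n. smult (s m) (monom 1 m * (pderiv ^^ m) p))"
    and s0: "\<And>m. m > n \<Longrightarrow> s m = 0"
    unfolding is_gen_stirling2_def by blast
  define t where "t m = of_nat (a + d * m) * s m
      + (if m = 0 then 0 else of_nat d * s (m - 1))" for m
  have "(gen_euler_op d a ^^ Suc n) p
      = (\<Sum>m=0..Suc n. smult (t m) (monom 1 m * (pderiv ^^ m) p))" for p
  proof -
    define T where "T m = monom 1 m * (pderiv ^^ m) p" for m
    have step: "gen_euler_op d a (T m) = smult (of_nat (a + d * m)) (T m) + smult (of_nat d) (T (Suc m))"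
      for m
      unfolding gen_euler_op_def T_def euler_op_term
      by (simp add: smult_add_right smult_add_left)
    have "(gen_euler_op d a ^^ Suc n) p = (\<Sum>m=0..n. smult (s m) (gen_euler_op d a (T m)))"
      by (simp add: s gen_euler_op_sum gen_euler_op_smult T_def)
    also have "\<dots> = (\<Sum>m=0..n. smult (of_nat (a + d * m) * s m) (T m))
        + (\<Sum>m=0..n. smult (of_nat d * s m) (T (Suc m)))"
      unfolding step by (simp only: smult_add_right smult_smult sum.distrib mult.commute)
    also have "(\<Sum>m=0..n. smult (of_nat (a + d * m) * s m) (T m))
        = (\<Sum>m=0..Suc n. smult (of_nat (a + d * m) * s m) (T m))"
      by (simp add: s0)
    also have "(\<Sum>m=0..n. smult (of_nat d * s m) (T (Suc m)))
        = (\<Sum>m=0..Suc n. smult (if m = 0 then 0 else of_nat d * s (m - 1)) (T m))"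
      by (subst sum.atLeast0_atMost_Suc_shift) simp
    finally show ?thesis
      unfolding t_def T_def[symmetric] by (simp only: smult_add_left sum.distrib)
  qed
  moreover have "\<forall>m>Suc n. t m = 0" by (auto simp: t_def s0)
  ultimately have "is_gen_stirling2 d a (Suc n) t"
    unfolding is_gen_stirling2_def by blast
  then show ?case by blast
qed

lemma pderiv_funpow_monom_less: "k < m \<Longrightarrow> (pderiv ^^ m) (monom 1 k :: rat poly) = 0"
proof -
  have zero: "(pderiv ^^ j) (0 :: rat poly) = 0" for j by (induction j) simp_all
  have "\<forall>c. (pderiv ^^ m) (monom c k :: rat poly) = 0" if "k < m" for m
    using that
  proof (induction m arbitrary: k)
    case (Suc m)
    show ?case
      by (cases k) (use Suc zero in \<open>auto simp: funpow_Suc_right pderiv_monom simp del: funpow.simps\<close>)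
  qed simp
  then show "k < m \<Longrightarrow> (pderiv ^^ m) (monom 1 k :: rat poly) = 0" by blast
qed

lemma pderiv_funpow_monom_self: "(pderiv ^^ k) (monom c k :: rat poly) = monom (fact k * c) 0"
  by (induction k arbitrary: c)
     (simp_all add: funpow_Suc_right pderiv_monom mult_ac del: funpow.simps)

lemma gen_stirling2_unique:
  assumes "is_gen_stirling2 d a n s" "is_gen_stirling2 d a n t"
  shows "s = t"
proof
  fix k
  show "s k = t k"
  proof (induction k rule: less_induct)
    case (less k)
    show ?case
    proof (cases "k \<le> n")
      case False
      then show ?thesis using assms by (simp add: is_gen_stirling2_def)
    next
      case True
      let ?T = "\<lambda>m. monom 1 m * (pderiv ^^ m) (monom 1 k :: rat poly)"
      have eq: "(\<Sum>m=0..n. smult (s m) (?T m)) = (\<Sum>m=0..n. smult (t m) (?T m))"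
        using assms unfolding is_gen_stirling2_def by metis
      have cut: "(\<Sum>m=0..n. smult (u m) (?T m)) = (\<Sum>m\<in>{0..<k}. smult (u m) (?T m)) + smult (u k) (?T k)"
        for u
      proof -
        have "(\<Sum>m=0..n. smult (u m) (?T m)) = (\<Sum>m\<in>{0..<Suc k}. smult (u m) (?T m))"
          by (rule sum.mono_neutral_right) (use True in \<open>auto simp: pderiv_funpow_monom_less\<close>)
        then show ?thesis by simp
      qed
      have "(\<Sum>m\<in>{0..<k}. smult (s m) (?T m)) = (\<Sum>m\<in>{0..<k}. smult (t m) (?T m))"
        by (rule sum.cong) (simp_all add: less)
      then have "smult (s k) (?T k) = smult (t k) (?T k)"
        using eq unfolding cut by simp
      then show ?thesis
        by (simp add: pderiv_funpow_monom_self mult_monom smult_monom)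
    qed
  qed
qed

lemma is_gen_stirling2_gen_stirling2: "is_gen_stirling2 d a n (gen_stirling2 d a n)"
  unfolding gen_stirling2_def
  using gen_stirling2_exists gen_stirling2_unique by (metis theI)

definition gen_bernoulli :: "nat \<Rightarrow> nat \<Rightarrow> nat \<Rightarrow> rat" where
  "gen_bernoulli d a n =
     (\<Sum>m=0..n. (-1) ^ m * (1 / (of_nat m + 1)) * gen_stirling2 d a n m * fact m)"

definition gen_bernoulli_poly :: "nat \<Rightarrow> nat \<Rightarrow> nat \<Rightarrow> rat poly" where
  "gen_bernoulli_poly d a n =
     (\<Sum>m=0..n. smult (of_nat (n choose m) * gen_bernoulli d a (n - m)) (monom 1 m))"

end

theory Submission
  imports Defs
begin

text \<open>Let \<open>L\<close> be the linear functional on rational polynomials with \<open>L (x ^ k) = bernoulli k\<close>.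
  The recurrence of the Bernoulli numbers says \<open>L (p (x + 1)) - L (p x) = p' 0\<close>; applied to
  falling factorials \<open>x (x - 1) \<cdots> (x - m)\<close> this gives that \<open>L\<close> sends the falling factorial of
  order \<open>m\<close> to \<open>(-1) ^ m * m! / (m + 1)\<close>. Evaluating the operator identity at the monomials shows
  that the generalized Stirling numbers are the coefficients of \<open>(a + d x) ^ n\<close> in the basis of
  falling factorials, so that \<open>gen_bernoulli d a n = L ((a + d x) ^ n)\<close>. The theorem then follows
  from the binomial theorem and trinomial revision.\<close>

definition bernoulli_functional :: "rat poly \<Rightarrow> rat" where
  "bernoulli_functional p = (\<Sum>i\<le>degree p. coeff p i * bernoulli i)"

text \<open>Coefficients beyond the degree vanish. The free bound \<open>N\<close> lets polynomials
  of different degrees share one index range, as additivity requires.\<close>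

lemma bernoulli_functional_altdef:
  assumes "degree p \<le> N"
  shows "bernoulli_functional p = (\<Sum>i\<le>N. coeff p i * bernoulli i)"
  unfolding bernoulli_functional_def
  by (rule sum.mono_neutral_left) (use assms in \<open>auto simp: coeff_eq_0\<close>)

lemma bernoulli_functional_add:
  "bernoulli_functional (p + q) = bernoulli_functional p + bernoulli_functional q"
proof -
  define N where "N = max (degree p) (degree q)"
  have "degree p \<le> N" "degree q \<le> N" "degree (p + q) \<le> N"
    by (auto simp: N_def intro: degree_add_le_max)
  then show ?thesis
    by (simp add: bernoulli_functional_altdef sum.distrib algebra_simps)
qed

lemma bernoulli_functional_smult:
  "bernoulli_functional (smult c p) = c * bernoulli_functional p"
  using bernoulli_functional_altdef[of "smult c p" "degree p"]
  by (simp add: degree_smult_le bernoulli_functional_def sum_distrib_left mult.assoc)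

lemma bernoulli_functional_sum:
  "bernoulli_functional (sum f A) = (\<Sum>i\<in>A. bernoulli_functional (f i))"
  by (induction A rule: infinite_finite_induct)
     (simp_all add: bernoulli_functional_add bernoulli_functional_def[of 0])

lemma bernoulli_functional_diff:
  "bernoulli_functional (p - q) = bernoulli_functional p - bernoulli_functional q"
  using bernoulli_functional_add[of "p - q" q] by simp

lemma bernoulli_functional_monom: "bernoulli_functional (monom 1 n) = bernoulli n"
proof -
  have "bernoulli_functional (monom 1 n) = (\<Sum>i\<le>n. coeff (monom 1 n) i * bernoulli i)"
    by (rule bernoulli_functional_altdef) (simp add: degree_monom_le)
  also have "\<dots> = (\<Sum>i\<le>n. if i = n then bernoulli i else 0)"
    by (intro sum.cong) auto
  finally show ?thesis by simp
qed

text \<open>This is the defining recurrence at index \<open>n - 1\<close>, cleared of its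
  denominator: the last summand is \<open>n * bernoulli (n - 1)\<close>. The value 1 at
  \<open>n = 1\<close> comes from \<open>bernoulli 0 = 1\<close>.\<close>

lemma sum_binomial_bernoulli:
  "(\<Sum>k<n. of_nat (n choose k) * bernoulli k) = (if n = 1 then 1 else 0)"
proof (cases n)
  case (Suc m)
  show ?thesis
  proof (cases "m = 0")
    case True
    then show ?thesis by (simp add: Suc bernoulli.simps[of 0])
  next
    case False
    have "of_nat (Suc m) * bernoulli m = - (\<Sum>k<m. of_nat (Suc m choose k) * bernoulli k)"
      using False bernoulli.simps[of m] by (simp add: atLeast0LessThan field_simps)
    then show ?thesis using False by (simp add: Suc)
  qed
qed simp

lemma linear_power_expand:
  "[:a, b:] ^ n = (\<Sum>k\<le>n. smult (of_nat (n choose k) * b ^ k * a ^ (n - k)) (monom 1 k))"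
  for a b :: rat
proof -
  have "[:a, b:] = monom b 1 + monom a 0" by (simp add: monom_altdef)
  then have "[:a, b:] ^ n = (\<Sum>k\<le>n. of_nat (n choose k) * monom b 1 ^ k * monom a 0 ^ (n - k))"
    by (simp only: binomial_ring)
  also have "\<dots> = (\<Sum>k\<le>n. smult (of_nat (n choose k) * b ^ k * a ^ (n - k)) (monom 1 k))"
    by (intro sum.cong)
       (simp_all add: monom_power mult_monom smult_monom of_nat_monom mult.assoc)
  finally show ?thesis .
qed

lemma bernoulli_functional_linear_power:
  "bernoulli_functional ([:a, b:] ^ n)
     = (\<Sum>k\<le>n. of_nat (n choose k) * b ^ k * a ^ (n - k) * bernoulli k)"
  by (simp add: linear_power_expand bernoulli_functional_sum bernoulli_functional_smult
      bernoulli_functional_monom)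

lemma pcompose_monom_1: "monom 1 n \<circ>\<^sub>p q = q ^ n"
  for q :: "'a :: comm_semiring_1 poly"
  by (induction n) (simp_all add: monom_0 monom_Suc pcompose_pCons)

text \<open>By linearity it suffices to treat monomials. There the top term of the expanded power
  cancels against \<open>bernoulli n\<close>, and \<open>sum_binomial_bernoulli\<close> evaluates
  the rest.\<close>

lemma bernoulli_functional_shift:
  "bernoulli_functional (p \<circ>\<^sub>p [:1, 1:]) - bernoulli_functional p = coeff p 1"
proof -
  have monom: "bernoulli_functional ([:1, 1:] ^ n) - bernoulli n = (if n = 1 then 1 else 0)" for n
    using sum_binomial_bernoulli[of n]
    by (simp add: bernoulli_functional_linear_power flip: lessThan_Suc_atMost)
  have p: "p = (\<Sum>i\<le>degree p. smult (coeff p i) (monom 1 i))"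
    by (simp add: smult_monom poly_as_sum_of_monoms)
  have "p \<circ>\<^sub>p [:1, 1:] = (\<Sum>i\<le>degree p. smult (coeff p i) ([:1, 1:] ^ i))"
    by (subst p) (simp add: pcompose_sum pcompose_smult pcompose_monom_1)
  then have "bernoulli_functional (p \<circ>\<^sub>p [:1, 1:]) - bernoulli_functional p
      = (\<Sum>i\<le>degree p. coeff p i * (bernoulli_functional ([:1, 1:] ^ i) - bernoulli i))"
    by (simp add: bernoulli_functional_sum bernoulli_functional_smult
        bernoulli_functional_def[of p] sum_subtractf algebra_simps)
  also have "\<dots> = (\<Sum>i\<le>degree p. if i = 1 then coeff p i else 0)"
    unfolding monom by (intro sum.cong) auto
  \<comment> \<open>For constant \<open>p\<close> the index 1 lies outside the range of summation,
    but then \<open>coeff p 1\<close> is 0 as well.\<close>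
  also have "\<dots> = coeff p 1"
    by (simp add: coeff_eq_0)
  finally show ?thesis .
qed

definition ffact_poly :: "nat \<Rightarrow> rat poly" where
  "ffact_poly m = (\<Prod>i<m. [:- of_nat i, 1:])"

lemma ffact_poly_0 [simp]: "ffact_poly 0 = 1"
  by (simp add: ffact_poly_def)

lemma ffact_poly_Suc [simp]: "ffact_poly (Suc m) = ffact_poly m * [:- of_nat m, 1:]"
  by (simp add: ffact_poly_def)

text \<open>The shift turns each factor \<open>x - i\<close> into \<open>x - (i - 1)\<close>: the
  factor \<open>x + 1\<close> appears in front and the last factor \<open>x - m\<close> is
  lost.\<close>

lemma ffact_poly_shift: "ffact_poly (Suc m) \<circ>\<^sub>p [:1, 1:] = [:1, 1:] * ffact_poly m"
proof (induction m)
  case 0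
  show ?case by (simp add: pcompose_pCons)
next
  case (Suc m)
  have "[:- of_nat (Suc m), 1:] \<circ>\<^sub>p [:1, 1:] = [:- of_nat m, 1 :: rat:]"
    by (simp add: pcompose_pCons)
  then show ?case
    using Suc by (subst ffact_poly_Suc, subst pcompose_mult) (simp only: ffact_poly_Suc mult.assoc)
qed

text \<open>Both terms contain \<open>ffact_poly m\<close>, and the cofactors \<open>x + 1\<close>
  and \<open>x - m\<close> differ by the constant \<open>m + 1\<close>. This is the discrete
  analogue of differentiating a power.\<close>

lemma ffact_poly_difference:
  "ffact_poly (Suc m) \<circ>\<^sub>p [:1, 1:] - ffact_poly (Suc m) = smult (of_nat (Suc m)) (ffact_poly m)"
proof -
  have "ffact_poly (Suc m) \<circ>\<^sub>p [:1, 1:] - ffact_poly (Suc m)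
      = ([:1, 1:] - [:- of_nat m, 1:]) * ffact_poly m"
    unfolding ffact_poly_shift by (simp only: ffact_poly_Suc left_diff_distrib
        mult.commute[of "ffact_poly m"])
  also have "[:1, 1:] - [:- of_nat m, 1:] = [:of_nat (Suc m) :: rat:]" by simp
  finally show ?thesis by simp
qed

lemma coeff_0_ffact_poly_Suc: "coeff (ffact_poly (Suc m)) 0 = 0"
  by (induction m) (simp_all add: coeff_mult_0)

text \<open>Since the constant coefficient is 0, each new factor \<open>x - i\<close> merely
  multiplies the linear coefficient by \<open>-i\<close>.\<close>

lemma coeff_1_ffact_poly_Suc: "coeff (ffact_poly (Suc m)) 1 = (-1) ^ m * fact m"
proof (induction m)
  case (Suc m)
  then show ?case
    using coeff_0_ffact_poly_Suc[of m]
    by (subst ffact_poly_Suc) (simp add: coeff_mult algebra_simps del: ffact_poly_Suc)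
qed simp

lemma bernoulli_functional_ffact_poly:
  "bernoulli_functional (ffact_poly m) = (-1) ^ m * fact m / of_nat (Suc m)"
proof -
  have "of_nat (Suc m) * bernoulli_functional (ffact_poly m) = (-1) ^ m * fact m"
    using bernoulli_functional_shift[of "ffact_poly (Suc m)"]
    by (simp only: bernoulli_functional_diff[symmetric] ffact_poly_difference
        bernoulli_functional_smult coeff_1_ffact_poly_Suc)
  then show ?thesis by (simp add: field_simps del: of_nat_Suc)
qed

text \<open>Monomials are eigenvectors of the Euler operator \<open>E\<close>, and
  \<open>euler_op_term\<close> says that passing from \<open>m\<close> to \<open>m + 1\<close>
  composes with \<open>E - m\<close>. Hence the eigenvalue gains the factor \<open>k - m\<close>; it
  is 0 once \<open>m > k\<close>.\<close>

lemma monom_mult_pderiv_funpow_monom: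
  "monom 1 m * (pderiv ^^ m) (monom 1 k) = monom (poly (ffact_poly m) (of_nat k)) k"
proof (induction m)
  case (Suc m)
  have "monom 1 (Suc m) * (pderiv ^^ Suc m) (monom 1 k)
      = euler_op (monom 1 m * (pderiv ^^ m) (monom 1 k))
        - smult (of_nat m) (monom 1 m * (pderiv ^^ m) (monom 1 k))"
    by (simp only: euler_op_term add_diff_cancel_left')
  also have "\<dots> = monom (poly (ffact_poly (Suc m)) (of_nat k)) k"
    unfolding Suc by (cases k) (simp_all add: euler_op_def pderiv_monom mult_monom smult_monom
        diff_monom minus_monom algebra_simps)
  finally show ?case .
qed simp

lemma gen_euler_op_funpow_monom:
  "(gen_euler_op d a ^^ n) (monom 1 k) = monom (of_nat (a + d * k) ^ n) k"
proof (induction n)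
  case (Suc n)
  have "gen_euler_op d a (monom c k) = monom (of_nat (a + d * k) * c) k" for c
    by (cases k) (simp_all add: gen_euler_op_def euler_op_def pderiv_monom mult_monom smult_monom
        add_monom algebra_simps)
  then show ?case using Suc by simp
qed simp

lemma linear_power_eq_sum_ffact_poly:
  "[:of_nat a, of_nat d:] ^ n = (\<Sum>m=0..n. smult (gen_stirling2 d a n m) (ffact_poly m))"
    (is "?p = ?q")
proof -
  \<comment> \<open>Both sides are the eigenvalue on \<open>monom 1 k\<close> of the two operators
    in the identity that defines the Stirling numbers.\<close>
  have "poly ?p (of_nat k) = poly ?q (of_nat k)" for k
  proof -
    have "monom (of_nat (a + d * k) ^ n) k
        = (\<Sum>m=0..n. smult (gen_stirling2 d a n m) (monom (poly (ffact_poly m) (of_nat k)) k))"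
      using is_gen_stirling2_gen_stirling2[of d a n]
      by (simp only: is_gen_stirling2_def gen_euler_op_funpow_monom[symmetric]
          monom_mult_pderiv_funpow_monom[symmetric])
    then have "coeff (monom (of_nat (a + d * k) ^ n) k) k = coeff
        (\<Sum>m=0..n. smult (gen_stirling2 d a n m) (monom (poly (ffact_poly m) (of_nat k)) k)) k"
      by (rule arg_cong)
    then show ?thesis
      by (simp add: coeff_sum poly_sum poly_power mult.commute)
  qed
  \<comment> \<open>Agreement at all natural numbers gives the difference infinitely many roots, so
    it is the zero polynomial.\<close>
  then have "range of_nat \<subseteq> {x. poly (?p - ?q) x = 0}" by auto
  moreover have "infinite (range (of_nat :: nat \<Rightarrow> rat))"
    by (simp add: range_inj_infinite inj_of_nat)
  ultimately have "?p - ?q = 0"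
    using poly_roots_finite finite_subset by blast
  then show ?thesis by simp
qed

lemma gen_bernoulli_eq_functional:
  "gen_bernoulli d a n = bernoulli_functional ([:of_nat a, of_nat d:] ^ n)"
  unfolding linear_power_eq_sum_ffact_poly gen_bernoulli_def
  by (simp add: bernoulli_functional_sum bernoulli_functional_smult bernoulli_functional_ffact_poly
      field_simps)

lemma smult_sum_right: "smult c (sum f A) = (\<Sum>i\<in>A. smult c (f i))"
  by (induction A rule: infinite_finite_induct) (simp_all add: smult_add_right)

text \<open>Both sides equal \<open>(n choose (m + k)) * ((m + k) choose m)\<close>: they count the
  ordered pairs of disjoint subsets of sizes \<open>m\<close> and \<open>k\<close>.\<close>

lemma trinomial_revision:
  assumes "m + k \<le> n"
  shows "(n choose m) * (n - m choose k) = (n choose k) * (n - k choose m)"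
  using assms choose_mult[of m "m + k" n] choose_mult[of k "m + k" n]
    binomial_symmetric[of m "m + k"]
  by simp

theorem mainTheorem15:
  fixes d a n :: nat
  assumes "d \<ge> 1"
  shows "gen_bernoulli_poly d a n =
    (\<Sum>m=0..n. smult (of_nat (n choose m) * of_nat d ^ m * bernoulli m)
                 ((monom (of_nat a) 0 + monom 1 1) ^ (n - m)))"
proof -
  \<comment> \<open>The contribution of \<open>bernoulli k\<close> to the coefficient of
    \<open>x ^ m\<close>, in the form obtained from the left-hand side.\<close>
  define t where "t m k = smult (of_nat ((n choose m) * (n - m choose k)) * of_nat d ^ k
      * of_nat a ^ (n - m - k) * bernoulli k) (monom (1 :: rat) m)" for m k
  \<comment> \<open>Writing the triangle \<open>m + k \<le> n\<close> as a condition on two full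
    ranges makes it symmetric, so that the sums can be exchanged.\<close>
  have "gen_bernoulli_poly d a n = (\<Sum>m\<in>{0..n}. \<Sum>k\<in>{k\<in>{0..n}. m + k \<le> n}. t m k)"
    unfolding gen_bernoulli_poly_def
  proof (intro sum.cong refl)
    fix m assume "m \<in> {0..n}"
    then have "{k\<in>{0..n}. m + k \<le> n} = {..n - m}" by auto
    then show "smult (of_nat (n choose m) * gen_bernoulli d a (n - m)) (monom 1 m)
        = (\<Sum>k\<in>{k\<in>{0..n}. m + k \<le> n}. t m k)"
      by (simp add: t_def gen_bernoulli_eq_functional bernoulli_functional_linear_power
          sum_distrib_left smult_sum mult_ac)
  qed
  also have "\<dots> = (\<Sum>k\<in>{0..n}. \<Sum>m\<in>{m\<in>{0..n}. m + k \<le> n}. t m k)"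
    by (rule sum.swap_restrict) simp_all
  also have "\<dots> = (\<Sum>k=0..n. smult (of_nat (n choose k) * of_nat d ^ k * bernoulli k)
                 ((monom (of_nat a) 0 + monom 1 1) ^ (n - k)))"
  proof (intro sum.cong refl)
    fix k assume "k \<in> {0..n}"
    then have set: "{m\<in>{0..n}. m + k \<le> n} = {..n - k}" by auto
    have "monom (of_nat a) 0 + monom 1 1 = [:of_nat a, 1 :: rat:]"
      by (simp add: monom_altdef)
    \<comment> \<open>Expanding \<open>(a + x) ^ (n - k)\<close> gives the terms
      \<open>t m k\<close>, except that the binomial factors choose \<open>k\<close> before
      \<open>m\<close>.\<close>
    then have "smult (of_nat (n choose k) * of_nat d ^ k * bernoulli k)
          ((monom (of_nat a) 0 + monom 1 1) ^ (n - k))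
        = (\<Sum>m\<le>n - k. smult (of_nat ((n choose k) * (n - k choose m)) * of_nat d ^ k
            * of_nat a ^ (n - k - m) * bernoulli k) (monom 1 m))"
      by (simp add: linear_power_expand smult_sum_right mult_ac)
    also have "\<dots> = (\<Sum>m\<le>n - k. t m k)"
    proof (intro sum.cong refl)
      fix m assume "m \<in> {..n - k}"
      with \<open>k \<in> {0..n}\<close> have "m + k \<le> n" by auto
      then show "smult (of_nat ((n choose k) * (n - k choose m)) * of_nat d ^ k
            * of_nat a ^ (n - k - m) * bernoulli k) (monom 1 m) = t m k"
        unfolding t_def trinomial_revision[OF \<open>m + k \<le> n\<close>] by (simp only: diff_commute)
    qed
    finally show "(\<Sum>m\<in>{m\<in>{0..n}. m + k \<le> n}. t m k)
        = smult (of_nat (n choose k) * of_nat d ^ k * bernoulli k)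
          ((monom (of_nat a) 0 + monom 1 1) ^ (n - k))"
      unfolding set by simp
  qed
  finally show ?thesis .
qed

end
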